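(* Let $J$ be a positive compatible almost complex structure on a symplectic manifold $(M,\omega)$. If the Nijenhuis tensor $N^J$ is parallel for the Levi-Civita connection $\nabla^{g_J}$ associated to $g_J$, then $J$ is integrable; that is, $$\nabla^{g_J} N^J=0 \iff N^J=0.$$
   Context: An almost complex structure $J$ on $M$ is a smooth field of endomorphisms of $TM$ with $J^2=-\mathrm{Id}$. It is compatible with $\omega$ if $g_J(X,Y):=\omega(X,JY)$ is symmetric, and positive if moreover $g_J$ is a Riemannian metric. Its Nijenhuis tensor is the $(1,2)$-tensor $N^J(X,Y)=[JX,JY]-J[JX,Y]-J[X,JY]-[X,Y]$. Integrability of $J$ is equivalent to $N^J=0$ (Newlander–Nirenberg). *)

theory Defs
  imports "HOL-Analysis.Analysis" "HOL-Library.Function_Algebras"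
begin

text \<open>Function types carry the pointwise vector space structure; for ring-valued functions
  \<open>f * g\<close> is the pointwise product.\<close>

instantiation "fun" :: (type, real_vector) real_vector
begin

definition scaleR_fun :: "real \<Rightarrow> ('a \<Rightarrow> 'b) \<Rightarrow> 'a \<Rightarrow> 'b"
  where "scaleR_fun c f = (\<lambda>x. c *\<^sub>R f x)"

instance
  by standard (simp_all add: scaleR_fun_def fun_eq_iff scaleR_add_right scaleR_add_left)

end

section \<open>Smooth manifolds\<close>

text \<open>\<open>Ck_on n S f\<close>: the function \<open>f\<close> is of class \<open>C\<^sup>n\<close> on the open set \<open>S\<close>.\<close>

primrec Ck_on :: "nat \<Rightarrow> 'a::real_normed_vector set \<Rightarrow> ('a \<Rightarrow> 'b::real_normed_vector) \<Rightarrow> bool"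
  where
    "Ck_on 0 S f \<longleftrightarrow> continuous_on S f"
  | "Ck_on (Suc n) S f \<longleftrightarrow> (\<forall>x\<in>S. f differentiable (at x)) \<and>
       (\<forall>v. Ck_on n S (\<lambda>x. frechet_derivative f (at x) v))"

definition smooth_on :: "'a::real_normed_vector set \<Rightarrow> ('a \<Rightarrow> 'b::real_normed_vector) \<Rightarrow> bool"
  where "smooth_on S f \<longleftrightarrow> (\<forall>n. Ck_on n S f)"

text \<open>The manifold is the whole type \<open>'m\<close>; \<open>\<A>\<close> is a smooth atlas, not necessarily maximal,
  of charts \<open>(U, \<phi>)\<close>. Only the values of \<open>\<phi>\<close> on \<open>U\<close> matter.\<close>

type_synonym ('m, 'e) atlas = "('m set \<times> ('m \<Rightarrow> 'e)) set"

definition smooth_manifold ::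
    "('m::{t2_space, second_countable_topology}, 'e::euclidean_space) atlas \<Rightarrow> bool"
  where "smooth_manifold \<A> \<longleftrightarrow>
    (\<Union>(U, \<phi>)\<in>\<A>. U) = UNIV \<and>
    (\<forall>(U, \<phi>)\<in>\<A>. open U \<and> open (\<phi> ` U) \<and> homeomorphism U (\<phi> ` U) \<phi> (inv_into U \<phi>)) \<and>
    (\<forall>(U, \<phi>)\<in>\<A>. \<forall>(V, \<psi>)\<in>\<A>. smooth_on (\<phi> ` (U \<inter> V)) (\<psi> \<circ> inv_into U \<phi>))"

definition smooth_fun :: "('m, 'e::euclidean_space) atlas \<Rightarrow> ('m \<Rightarrow> real) set"
  where "smooth_fun \<A> = {f. \<forall>(U, \<phi>)\<in>\<A>. smooth_on (\<phi> ` U) (f \<circ> inv_into U \<phi>)}"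

section \<open>Tangent spaces and vector fields\<close>

text \<open>Tangent vectors at \<open>p\<close> are the derivations at \<open>p\<close> of the algebra of smooth functions.
  They are set to \<open>0\<close> on functions that are not smooth, so that two tangent vectors are equal
  as soon as they agree on the smooth functions.\<close>

type_synonym 'm tvec = "('m \<Rightarrow> real) \<Rightarrow> real"
type_synonym 'm vfield = "'m \<Rightarrow> 'm tvec"

definition tangent_space :: "('m, 'e::euclidean_space) atlas \<Rightarrow> 'm \<Rightarrow> 'm tvec set"
  where "tangent_space \<A> p = {v.
    (\<forall>f\<in>smooth_fun \<A>. \<forall>g\<in>smooth_fun \<A>. v (f + g) = v f + v g) \<and>
    (\<forall>c. \<forall>f\<in>smooth_fun \<A>. v (c *\<^sub>R f) = c * v f) \<and>
    (\<forall>f\<in>smooth_fun \<A>. \<forall>g\<in>smooth_fun \<A>. v (f * g) = f p * v g + g p * v f) \<and>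
    (\<forall>f. f \<notin> smooth_fun \<A> \<longrightarrow> v f = 0)}"

definition deriv_along :: "'m vfield \<Rightarrow> ('m \<Rightarrow> real) \<Rightarrow> 'm \<Rightarrow> real"
  where "deriv_along X f = (\<lambda>p. X p f)"

definition vector_fields :: "('m, 'e::euclidean_space) atlas \<Rightarrow> 'm vfield set"
  where "vector_fields \<A> = {X. (\<forall>p. X p \<in> tangent_space \<A> p) \<and>
    (\<forall>f\<in>smooth_fun \<A>. deriv_along X f \<in> smooth_fun \<A>)}"

definition lie_bracket :: "'m vfield \<Rightarrow> 'm vfield \<Rightarrow> 'm vfield"
  where "lie_bracket X Y = (\<lambda>p f. X p (deriv_along Y f) - Y p (deriv_along X f))"

definition scale_field :: "('m \<Rightarrow> real) \<Rightarrow> 'm vfield \<Rightarrow> 'm vfield"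
  where "scale_field f X = (\<lambda>p. f p *\<^sub>R X p)"

section \<open>Tensor fields\<close>

definition bilinear_field ::
    "('m \<Rightarrow> 'm tvec \<Rightarrow> 'm tvec \<Rightarrow> real) \<Rightarrow> 'm vfield \<Rightarrow> 'm vfield \<Rightarrow> 'm \<Rightarrow> real"
  where "bilinear_field B X Y = (\<lambda>p. B p (X p) (Y p))"

definition endo_field :: "('m \<Rightarrow> 'm tvec \<Rightarrow> 'm tvec) \<Rightarrow> 'm vfield \<Rightarrow> 'm vfield"
  where "endo_field J X = (\<lambda>p. J p (X p))"

definition smooth_bilinear_form ::
    "('m, 'e::euclidean_space) atlas \<Rightarrow> ('m \<Rightarrow> 'm tvec \<Rightarrow> 'm tvec \<Rightarrow> real) \<Rightarrow> bool"
  where "smooth_bilinear_form \<A> B \<longleftrightarrow>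
    (\<forall>p. \<forall>u\<in>tangent_space \<A> p. \<forall>v\<in>tangent_space \<A> p. \<forall>w\<in>tangent_space \<A> p. \<forall>a b.
       B p (a *\<^sub>R u + b *\<^sub>R v) w = a * B p u w + b * B p v w \<and>
       B p w (a *\<^sub>R u + b *\<^sub>R v) = a * B p w u + b * B p w v) \<and>
    (\<forall>X\<in>vector_fields \<A>. \<forall>Y\<in>vector_fields \<A>. bilinear_field B X Y \<in> smooth_fun \<A>)"

definition smooth_endomorphism ::
    "('m, 'e::euclidean_space) atlas \<Rightarrow> ('m \<Rightarrow> 'm tvec \<Rightarrow> 'm tvec) \<Rightarrow> bool"
  where "smooth_endomorphism \<A> J \<longleftrightarrow>
    (\<forall>p. \<forall>v\<in>tangent_space \<A> p. J p v \<in> tangent_space \<A> p) \<and>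
    (\<forall>p. \<forall>v\<in>tangent_space \<A> p. \<forall>w\<in>tangent_space \<A> p. \<forall>a b.
       J p (a *\<^sub>R v + b *\<^sub>R w) = a *\<^sub>R J p v + b *\<^sub>R J p w) \<and>
    (\<forall>X\<in>vector_fields \<A>. endo_field J X \<in> vector_fields \<A>)"

section \<open>Symplectic forms and Riemannian metrics\<close>

definition ext_deriv2 ::
    "('m \<Rightarrow> 'm tvec \<Rightarrow> 'm tvec \<Rightarrow> real) \<Rightarrow> 'm vfield \<Rightarrow> 'm vfield \<Rightarrow> 'm vfield \<Rightarrow> 'm \<Rightarrow> real"
  where "ext_deriv2 \<omega> X Y Z =
      deriv_along X (bilinear_field \<omega> Y Z) - deriv_along Y (bilinear_field \<omega> X Z)
    + deriv_along Z (bilinear_field \<omega> X Y) - bilinear_field \<omega> (lie_bracket X Y) Z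
    + bilinear_field \<omega> (lie_bracket X Z) Y - bilinear_field \<omega> (lie_bracket Y Z) X"

definition symplectic_form ::
    "('m, 'e::euclidean_space) atlas \<Rightarrow> ('m \<Rightarrow> 'm tvec \<Rightarrow> 'm tvec \<Rightarrow> real) \<Rightarrow> bool"
  where "symplectic_form \<A> \<omega> \<longleftrightarrow>
    smooth_bilinear_form \<A> \<omega> \<and>
    (\<forall>p. \<forall>v\<in>tangent_space \<A> p. \<omega> p v v = 0) \<and>
    (\<forall>p. \<forall>v\<in>tangent_space \<A> p. (\<forall>w\<in>tangent_space \<A> p. \<omega> p v w = 0) \<longrightarrow> v = 0) \<and>
    (\<forall>X\<in>vector_fields \<A>. \<forall>Y\<in>vector_fields \<A>. \<forall>Z\<in>vector_fields \<A>. ext_deriv2 \<omega> X Y Z = 0)"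

definition symplectic_manifold ::
    "('m::{t2_space, second_countable_topology}, 'e::euclidean_space) atlas \<Rightarrow>
     ('m \<Rightarrow> 'm tvec \<Rightarrow> 'm tvec \<Rightarrow> real) \<Rightarrow> bool"
  where "symplectic_manifold \<A> \<omega> \<longleftrightarrow> smooth_manifold \<A> \<and> symplectic_form \<A> \<omega>"

definition symmetric_form ::
    "('m, 'e::euclidean_space) atlas \<Rightarrow> ('m \<Rightarrow> 'm tvec \<Rightarrow> 'm tvec \<Rightarrow> real) \<Rightarrow> bool"
  where "symmetric_form \<A> B \<longleftrightarrow>
    (\<forall>p. \<forall>v\<in>tangent_space \<A> p. \<forall>w\<in>tangent_space \<A> p. B p v w = B p w v)"

definition riemannian_metric ::
    "('m, 'e::euclidean_space) atlas \<Rightarrow> ('m \<Rightarrow> 'm tvec \<Rightarrow> 'm tvec \<Rightarrow> real) \<Rightarrow> bool"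
  where "riemannian_metric \<A> g \<longleftrightarrow>
    smooth_bilinear_form \<A> g \<and> symmetric_form \<A> g \<and>
    (\<forall>p. \<forall>v\<in>tangent_space \<A> p. v \<noteq> 0 \<longrightarrow> g p v v > 0)"

section \<open>Almost complex structures\<close>

definition almost_complex_structure ::
    "('m, 'e::euclidean_space) atlas \<Rightarrow> ('m \<Rightarrow> 'm tvec \<Rightarrow> 'm tvec) \<Rightarrow> bool"
  where "almost_complex_structure \<A> J \<longleftrightarrow>
    smooth_endomorphism \<A> J \<and> (\<forall>p. \<forall>v\<in>tangent_space \<A> p. J p (J p v) = - v)"

definition assoc_metric ::
    "('m \<Rightarrow> 'm tvec \<Rightarrow> 'm tvec \<Rightarrow> real) \<Rightarrow> ('m \<Rightarrow> 'm tvec \<Rightarrow> 'm tvec) \<Rightarrow>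
     'm \<Rightarrow> 'm tvec \<Rightarrow> 'm tvec \<Rightarrow> real"
  where "assoc_metric \<omega> J = (\<lambda>p v w. \<omega> p v (J p w))"

definition compatible ::
    "('m, 'e::euclidean_space) atlas \<Rightarrow> ('m \<Rightarrow> 'm tvec \<Rightarrow> 'm tvec \<Rightarrow> real) \<Rightarrow>
     ('m \<Rightarrow> 'm tvec \<Rightarrow> 'm tvec) \<Rightarrow> bool"
  where "compatible \<A> \<omega> J \<longleftrightarrow> symmetric_form \<A> (assoc_metric \<omega> J)"

definition positive_compatible ::
    "('m, 'e::euclidean_space) atlas \<Rightarrow> ('m \<Rightarrow> 'm tvec \<Rightarrow> 'm tvec \<Rightarrow> real) \<Rightarrow>
     ('m \<Rightarrow> 'm tvec \<Rightarrow> 'm tvec) \<Rightarrow> bool"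
  where "positive_compatible \<A> \<omega> J \<longleftrightarrow>
    compatible \<A> \<omega> J \<and> riemannian_metric \<A> (assoc_metric \<omega> J)"

definition nijenhuis ::
    "('m \<Rightarrow> 'm tvec \<Rightarrow> 'm tvec) \<Rightarrow> 'm vfield \<Rightarrow> 'm vfield \<Rightarrow> 'm vfield"
  where "nijenhuis J X Y =
      lie_bracket (endo_field J X) (endo_field J Y)
    - endo_field J (lie_bracket (endo_field J X) Y)
    - endo_field J (lie_bracket X (endo_field J Y))
    - lie_bracket X Y"

section \<open>Connections\<close>

definition affine_connection ::
    "('m, 'e::euclidean_space) atlas \<Rightarrow> ('m vfield \<Rightarrow> 'm vfield \<Rightarrow> 'm vfield) \<Rightarrow> bool"
  where "affine_connection \<A> D \<longleftrightarrow>
    (\<forall>X\<in>vector_fields \<A>. \<forall>Y\<in>vector_fields \<A>. D X Y \<in> vector_fields \<A>) \<and>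
    (\<forall>X\<in>vector_fields \<A>. \<forall>Y\<in>vector_fields \<A>. \<forall>Z\<in>vector_fields \<A>.
       D (X + Y) Z = D X Z + D Y Z \<and> D X (Y + Z) = D X Y + D X Z) \<and>
    (\<forall>f\<in>smooth_fun \<A>. \<forall>X\<in>vector_fields \<A>. \<forall>Y\<in>vector_fields \<A>.
       D (scale_field f X) Y = scale_field f (D X Y) \<and>
       D X (scale_field f Y) = scale_field (deriv_along X f) Y + scale_field f (D X Y))"

definition torsion_free ::
    "('m, 'e::euclidean_space) atlas \<Rightarrow> ('m vfield \<Rightarrow> 'm vfield \<Rightarrow> 'm vfield) \<Rightarrow> bool"
  where "torsion_free \<A> D \<longleftrightarrow>
    (\<forall>X\<in>vector_fields \<A>. \<forall>Y\<in>vector_fields \<A>. D X Y - D Y X = lie_bracket X Y)"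

definition metric_connection ::
    "('m, 'e::euclidean_space) atlas \<Rightarrow> ('m \<Rightarrow> 'm tvec \<Rightarrow> 'm tvec \<Rightarrow> real) \<Rightarrow>
     ('m vfield \<Rightarrow> 'm vfield \<Rightarrow> 'm vfield) \<Rightarrow> bool"
  where "metric_connection \<A> g D \<longleftrightarrow>
    (\<forall>X\<in>vector_fields \<A>. \<forall>Y\<in>vector_fields \<A>. \<forall>Z\<in>vector_fields \<A>.
       deriv_along X (bilinear_field g Y Z) = bilinear_field g (D X Y) Z + bilinear_field g Y (D X Z))"

text \<open>By the fundamental theorem of Riemannian geometry, these conditions determine \<open>D\<close> on
  vector fields; its values on other arguments are irrelevant.\<close>

definition levi_civita_connection ::
    "('m, 'e::euclidean_space) atlas \<Rightarrow> ('m \<Rightarrow> 'm tvec \<Rightarrow> 'm tvec \<Rightarrow> real) \<Rightarrow>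
     ('m vfield \<Rightarrow> 'm vfield \<Rightarrow> 'm vfield) \<Rightarrow> bool"
  where "levi_civita_connection \<A> g D \<longleftrightarrow>
    affine_connection \<A> D \<and> torsion_free \<A> D \<and> metric_connection \<A> g D"

text \<open>The covariant derivative \<open>(D\<^bsub>Z\<^esub> N)(X, Y)\<close> of a \<open>(1,2)\<close>-tensor field \<open>N\<close>.\<close>

definition cov_deriv12 ::
    "('m vfield \<Rightarrow> 'm vfield \<Rightarrow> 'm vfield) \<Rightarrow> ('m vfield \<Rightarrow> 'm vfield \<Rightarrow> 'm vfield) \<Rightarrow>
     'm vfield \<Rightarrow> 'm vfield \<Rightarrow> 'm vfield \<Rightarrow> 'm vfield"
  where "cov_deriv12 D N Z X Y = D Z (N X Y) - N (D Z X) Y - N X (D Z Y)"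

end

theory Submission
  imports Defs
begin

text \<open>
  Put \<open>A\<^sub>X = D\<^sub>X J\<close>. It is skew for the metric \<open>g\<close>, and \<open>d\<omega> = 0\<close> gives \<open>A\<^bsub>JX\<^esub> = - J A\<^sub>X\<close> and
  \<open>g (N(X,Y)) Z = - 2 g (A\<^sub>Z X) (J Y)\<close>. Differentiating \<open>N(JX,Y) = - J N(X,Y)\<close> with \<open>N\<close> parallel
  yields \<open>N(A\<^sub>Z X,Y) = N(X,A\<^sub>Z Y) = - A\<^sub>Z N(X,Y)\<close>, so inside \<open>g (N(X,Y)) W\<close> the operators \<open>A\<^sub>Z\<close> move
  freely between the three slots, and therefore commute there. Commuting \<open>A\<^sub>Z\<close> with
  \<open>A\<^bsub>JZ\<^esub> = - J A\<^sub>Z\<close>, which anticommutes with it, shows \<open>N(A\<^sub>Z\<^sup>2 X,Y) = 0\<close>, that is \<open>A\<^sub>Z\<^sup>3 = 0\<close>. A nilpotent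
  skew operator vanishes, hence \<open>A = 0\<close> and \<open>N = 0\<close>.
\<close>

section \<open>Almost Kaehler algebra\<close>

text \<open>\<open>V\<close> plays the role of the vector fields, \<open>'r\<close> of the functions, and \<open>L X f\<close> is the derivative
  of \<open>f\<close> along \<open>X\<close>. The symplectic form is \<open>g (J X) Y\<close> and the Lie bracket is \<open>D X Y - D Y X\<close>.\<close>

locale almost_kaehler_algebra =
  fixes V :: "'v::real_vector set"
    and J :: "'v \<Rightarrow> 'v"
    and D :: "'v \<Rightarrow> 'v \<Rightarrow> 'v"
    and g :: "'v \<Rightarrow> 'v \<Rightarrow> 'r::real_vector"
    and L :: "'v \<Rightarrow> 'r \<Rightarrow> 'r"
  assumes subspace_V: "subspace V"
    and J_closed [simp]: "X \<in> V \<Longrightarrow> J X \<in> V"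
    and J_add: "\<lbrakk>X \<in> V; Y \<in> V\<rbrakk> \<Longrightarrow> J (X + Y) = J X + J Y"
    and J_J [simp]: "X \<in> V \<Longrightarrow> J (J X) = - X"
    and D_closed [simp]: "\<lbrakk>X \<in> V; Y \<in> V\<rbrakk> \<Longrightarrow> D X Y \<in> V"
    and D_add: "\<lbrakk>X \<in> V; Y \<in> V; Z \<in> V\<rbrakk> \<Longrightarrow> D X (Y + Z) = D X Y + D X Z"
    and g_add_left: "\<lbrakk>X \<in> V; Y \<in> V; Z \<in> V\<rbrakk> \<Longrightarrow> g (X + Y) Z = g X Z + g Y Z"
    and g_sym: "\<lbrakk>X \<in> V; Y \<in> V\<rbrakk> \<Longrightarrow> g X Y = g Y X"
    and g_J_left: "\<lbrakk>X \<in> V; Y \<in> V\<rbrakk> \<Longrightarrow> g (J X) Y = - g X (J Y)"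
    and g_definite: "\<lbrakk>X \<in> V; g X X = 0\<rbrakk> \<Longrightarrow> X = 0"
    and L_minus: "\<lbrakk>X \<in> V; Y \<in> V; Z \<in> V\<rbrakk> \<Longrightarrow> L X (- g Y Z) = - L X (g Y Z)"
    and D_metric: "\<lbrakk>X \<in> V; Y \<in> V; Z \<in> V\<rbrakk> \<Longrightarrow> L X (g Y Z) = g (D X Y) Z + g Y (D X Z)"
    and closed: "\<lbrakk>X \<in> V; Y \<in> V; Z \<in> V\<rbrakk> \<Longrightarrow>
      L X (g (J Y) Z) - L Y (g (J X) Z) + L Z (g (J X) Y)
      - g (J (D X Y - D Y X)) Z + g (J (D X Z - D Z X)) Y - g (J (D Y Z - D Z Y)) X = 0"
begin

definition A :: "'v \<Rightarrow> 'v \<Rightarrow> 'v"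
  where "A X Y = D X (J Y) - J (D X Y)"

definition bracket :: "'v \<Rightarrow> 'v \<Rightarrow> 'v"
  where "bracket X Y = D X Y - D Y X"

definition N :: "'v \<Rightarrow> 'v \<Rightarrow> 'v"
  where "N X Y = bracket (J X) (J Y) - J (bracket (J X) Y) - J (bracket X (J Y)) - bracket X Y"

section \<open>Additivity and nondegeneracy\<close>

lemma V_closed [simp]:
  shows "0 \<in> V"
    and "\<lbrakk>X \<in> V; Y \<in> V\<rbrakk> \<Longrightarrow> X + Y \<in> V"
    and "\<lbrakk>X \<in> V; Y \<in> V\<rbrakk> \<Longrightarrow> X - Y \<in> V"
    and "X \<in> V \<Longrightarrow> - X \<in> V"
  using subspace_V
  by (auto intro: subspace_0 subspace_add subspace_diff subspace_neg)

text \<open>Stated for an arbitrary map into an abelian group, so that it serves \<open>J\<close>,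
  \<open>D X\<close>, \<open>g\<close> and \<open>N\<close> alike.\<close>

lemma additive_on_V:
  fixes f :: "'v \<Rightarrow> 'w::ab_group_add"
  assumes add: "\<And>X Y. \<lbrakk>X \<in> V; Y \<in> V\<rbrakk> \<Longrightarrow> f (X + Y) = f X + f Y"
  shows "f 0 = 0"
    and "X \<in> V \<Longrightarrow> f (- X) = - f X"
    and "\<lbrakk>X \<in> V; Y \<in> V\<rbrakk> \<Longrightarrow> f (X - Y) = f X - f Y"
proof -
  show zero: "f 0 = 0" using add [of 0 0] by simp
  show minus: "f (- X) = - f X" if "X \<in> V" for X
    using add [of X "- X"] that by (simp add: zero eq_neg_iff_add_eq_0 add.commute)
  show "f (X - Y) = f X - f Y" if "X \<in> V" "Y \<in> V"
    using add [of X "- Y"] that by (simp add: minus)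
qed

lemma J_simps [simp]:
  shows "J 0 = 0"
    and "X \<in> V \<Longrightarrow> J (- X) = - J X"
    and "\<lbrakk>X \<in> V; Y \<in> V\<rbrakk> \<Longrightarrow> J (X + Y) = J X + J Y"
    and "\<lbrakk>X \<in> V; Y \<in> V\<rbrakk> \<Longrightarrow> J (X - Y) = J X - J Y"
  using additive_on_V [of J] J_add by auto

lemma D_simps [simp]:
  assumes "X \<in> V"
  shows "D X 0 = 0"
    and "Y \<in> V \<Longrightarrow> D X (- Y) = - D X Y"
    and "\<lbrakk>Y \<in> V; Z \<in> V\<rbrakk> \<Longrightarrow> D X (Y + Z) = D X Y + D X Z"
  using additive_on_V [of "D X"] D_add [OF assms] assms by auto

lemma g_left_simps [simp]:
  assumes "Z \<in> V"
  shows "g 0 Z = 0"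
    and "X \<in> V \<Longrightarrow> g (- X) Z = - g X Z"
    and "\<lbrakk>X \<in> V; Y \<in> V\<rbrakk> \<Longrightarrow> g (X + Y) Z = g X Z + g Y Z"
    and "\<lbrakk>X \<in> V; Y \<in> V\<rbrakk> \<Longrightarrow> g (X - Y) Z = g X Z - g Y Z"
  using additive_on_V [of "\<lambda>X. g X Z"] g_add_left assms by auto

lemma g_right_simps [simp]:
  assumes "Z \<in> V"
  shows "g Z 0 = 0"
    and "X \<in> V \<Longrightarrow> g Z (- X) = - g Z X"
    and "\<lbrakk>X \<in> V; Y \<in> V\<rbrakk> \<Longrightarrow> g Z (X + Y) = g Z X + g Z Y"
    and "\<lbrakk>X \<in> V; Y \<in> V\<rbrakk> \<Longrightarrow> g Z (X - Y) = g Z X - g Z Y"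
  using assms by (simp_all add: g_sym [of Z])

text \<open>Definiteness is applied to \<open>X - Y\<close> paired with itself. Identities for
  \<open>A\<close> and \<open>N\<close> are proved below by pairing both sides with an arbitrary
  \<open>Z\<close>.\<close>

lemma g_nondegenerate:
  assumes "X \<in> V" "Y \<in> V" "\<And>Z. Z \<in> V \<Longrightarrow> g X Z = g Y Z"
  shows "X = Y"
  using g_definite [of "X - Y"] assms by simp

section \<open>The covariant derivative of \<open>J\<close>\<close>

lemma A_closed [simp]: "\<lbrakk>X \<in> V; Y \<in> V\<rbrakk> \<Longrightarrow> A X Y \<in> V"
  by (simp add: A_def)

lemma N_closed [simp]: "\<lbrakk>X \<in> V; Y \<in> V\<rbrakk> \<Longrightarrow> N X Y \<in> V"
  by (simp add: N_def bracket_def)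

lemma A_simps [simp]:
  assumes "X \<in> V"
  shows "Y \<in> V \<Longrightarrow> A X (- Y) = - A X Y"
    and "\<lbrakk>Y \<in> V; Z \<in> V\<rbrakk> \<Longrightarrow> A X (Y + Z) = A X Y + A X Z"
  using assms by (simp_all add: A_def)

text \<open>Differentiate \<open>J (J Y) = - Y\<close> along \<open>X\<close>.\<close>

lemma A_J_right: "\<lbrakk>X \<in> V; Y \<in> V\<rbrakk> \<Longrightarrow> A X (J Y) = - J (A X Y)"
  by (simp add: A_def)

text \<open>Since \<open>D\<close> is metric, differentiating the skewness of \<open>J\<close> along
  \<open>X\<close> gives the skewness of \<open>A X\<close>.\<close>

lemma A_skew:
  assumes "X \<in> V" "Y \<in> V" "Z \<in> V"
  shows "g (A X Y) Z = - g Y (A X Z)"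
proof -
  have "L X (g (J Y) Z) = - L X (g Y (J Z))"
    using assms by (simp add: g_J_left L_minus)
  moreover have "g (A X Y) Z + g Y (A X Z) = L X (g (J Y) Z) + L X (g Y (J Z))"
    using D_metric [of X "J Y" Z] D_metric [of X Y "J Z"] assms by (simp add: A_def g_J_left)
  ultimately show ?thesis by (simp add: eq_neg_iff_add_eq_0)
qed

text \<open>\<open>g (A X Y) Z\<close> is the covariant derivative of the symplectic form along
  \<open>X\<close>. For a torsion-free connection, the exterior derivative of a two-form is the
  cyclic sum of its covariant derivative.\<close>

lemma g_A_cyclic:
  assumes "X \<in> V" "Y \<in> V" "Z \<in> V"
  shows "g (A X Y) Z + g (A Y Z) X + g (A Z X) Y = 0"
proof -
  \<comment> \<open>This moves every derivative \<open>D P Q\<close> into the left slot under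
    \<open>J\<close>, where it cancels against the bracket terms.\<close>
  have swap: "g (J U) (D P Q) = - g (J (D P Q)) U" if "U \<in> V" "P \<in> V" "Q \<in> V" for U P Q
    using that g_J_left [of U "D P Q"] g_sym [of U "J (D P Q)"] by simp
  have "g (A X Y) Z - g (A Y X) Z + g (A Z X) Y =
      L X (g (J Y) Z) - L Y (g (J X) Z) + L Z (g (J X) Y)
      - g (J (D X Y - D Y X)) Z + g (J (D X Z - D Z X)) Y - g (J (D Y Z - D Z Y)) X"
    using assms by (simp add: A_def D_metric swap)
  moreover have "g (A Y Z) X = - g (A Y X) Z"
    using assms A_skew [of Y Z X] g_sym [of Z "A Y X"] by simp
  ultimately show ?thesis
    using closed [OF assms] by simp
qed

lemma g_A_J_right:
  assumes "X \<in> V" "Y \<in> V" "Z \<in> V"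
  shows "g (A X (J Y)) Z = g (A X Y) (J Z)"
  using assms by (simp add: A_J_right g_J_left)

text \<open>The cyclic identity is used with \<open>J\<close> in one of the three places, in turn,
  and with \<open>J\<close> in all three. In the sum of the four relations the primed terms cancel,
  which leaves \<open>a + b + c = 0\<close>; comparison with the first relation gives
  \<open>a' = a\<close>.\<close>

lemma g_A_J_left:
  assumes "X \<in> V" "Y \<in> V" "Z \<in> V"
  shows "g (A (J X) Y) Z = g (A X Y) (J Z)"
proof -
  define a b c where "a = g (A X Y) (J Z)" and "b = g (A Y Z) (J X)" and "c = g (A Z X) (J Y)"
  define a' b' c' where "a' = g (A (J X) Y) Z" and "b' = g (A (J Y) Z) X" and "c' = g (A (J Z) X) Y"
  have 1: "a' + b + c = 0" and 2: "a + b' + c = 0" and 3: "a + b + c' = 0"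
    using g_A_cyclic [of "J X" Y Z] g_A_cyclic [of X "J Y" Z] g_A_cyclic [of X Y "J Z"] assms
    unfolding a_def b_def c_def a'_def b'_def c'_def by (simp_all add: g_A_J_right)
  \<comment> \<open>In each term the two copies of \<open>J\<close> outside the direction of
    differentiation combine to a minus sign.\<close>
  have "- a' - b' - c' = 0"
    using g_A_cyclic [of "J X" "J Y" "J Z"] assms
    unfolding a'_def b'_def c'_def by (simp add: g_A_J_right)
  moreover have "2 *\<^sub>R (a + b + c) =
      (a' + b + c) + (a + b' + c) + (a + b + c') + (- a' - b' - c')"
    by (simp add: scaleR_2)
  ultimately have "a + b + c = 0" using 1 2 3 by simp
  then have "a' + (b + c) = a + (b + c)" using 1 by (simp add: add.assoc)
  then show ?thesis by (simp add: a_def a'_def)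
qed

text \<open>Together with \<open>A_J_right\<close>, this makes \<open>A\<close> conjugate-linear in
  both arguments.\<close>

lemma A_J_left:
  assumes "X \<in> V" "Y \<in> V"
  shows "A (J X) Y = - J (A X Y)"
  using assms by (intro g_nondegenerate) (simp_all add: g_A_J_left g_J_left)

section \<open>The Nijenhuis tensor expressed through \<open>A\<close>\<close>

lemma g_N:
  assumes "X \<in> V" "Y \<in> V" "Z \<in> V"
  shows "g (N X Y) Z = - 2 *\<^sub>R g (A Z X) (J Y)"
proof -
  have "N X Y = A (J X) Y - A (J Y) X + J (A Y X) - J (A X Y)"
    using assms by (simp add: N_def bracket_def A_def algebra_simps)
  \<comment> \<open>By \<open>A_J_left\<close>, the terms differentiating along \<open>J X\<close>
    and \<open>J Y\<close> double the other two.\<close>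
  then have "N X Y = 2 *\<^sub>R (J (A Y X) - J (A X Y))"
    using assms by (simp add: A_J_left scaleR_2 algebra_simps)
  then have "g (N X Y) Z = 2 *\<^sub>R (g (A X Y) (J Z) - g (A Y X) (J Z))"
    using assms by (simp add: scaleR_2 g_J_left)
  \<comment> \<open>The cyclic identity at \<open>X\<close>, \<open>Y\<close>, \<open>J Z\<close>
    trades the antisymmetrization in \<open>X\<close> and \<open>Y\<close> for one term along
    \<open>J Z\<close>, whose \<open>J\<close> then moves to \<open>Y\<close>.\<close>
  moreover have "g (A X Y) (J Z) - g (A Y X) (J Z) = - g (A Z X) (J Y)"
  proof -
    have "g (A Y (J Z)) X = - g (A Y X) (J Z)"
      using assms A_skew [of Y "J Z" X] g_sym [of "J Z" "A Y X"] by simp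
    then show ?thesis
      using g_A_cyclic [of X Y "J Z"] assms
      by (simp add: g_A_J_left flip: eq_neg_iff_add_eq_0)
  qed
  ultimately show ?thesis by (simp add: scaleR_2)
qed

text \<open>Read off from \<open>g_N\<close>, where the first argument of \<open>N\<close> stands in
  the slot in which \<open>D\<close> is additive.\<close>

lemma N_add_left:
  assumes "X \<in> V" "Y \<in> V" "Z \<in> V"
  shows "N (X + Y) Z = N X Z + N Y Z"
  using assms by (intro g_nondegenerate) (simp_all add: g_N algebra_simps)

text \<open>\<open>A Z\<close> and \<open>J\<close> are skew and anticommute, so their product is
  skew; by \<open>g_N\<close> this is antisymmetry of \<open>N\<close>.\<close>

lemma N_skew:
  assumes "X \<in> V" "Y \<in> V"
  shows "N Y X = - N X Y"
proof (rule g_nondegenerate)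
  fix Z assume Z: "Z \<in> V"
  have "g (A Z Y) (J X) = - g (J Y) (A Z X)"
    using assms Z g_A_J_right [of Z Y X] A_skew [of Z "J Y" X] by simp
  also have "\<dots> = - g (A Z X) (J Y)"
    using assms Z by (simp add: g_sym)
  finally show "g (N Y X) Z = g (- N X Y) Z"
    using assms Z by (simp add: g_N)
qed (use assms in simp_all)

text \<open>On the right of \<open>g_N\<close>, a \<open>J\<close> can be shifted among all three
  slots, hence from \<open>X\<close> to the test field \<open>Z\<close>.\<close>

lemma N_J_left:
  assumes "X \<in> V" "Y \<in> V"
  shows "N (J X) Y = - J (N X Y)"
  using assms by (intro g_nondegenerate) (simp_all add: g_N g_A_J_right g_A_J_left g_J_left)

lemma N_eq_0_if_A_eq_0:
  assumes "\<And>X Y. \<lbrakk>X \<in> V; Y \<in> V\<rbrakk> \<Longrightarrow> A X Y = 0" and "X \<in> V" "Y \<in> V"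
  shows "N X Y = 0"
  using assms by (intro g_nondegenerate) (simp_all add: g_N)

section \<open>Consequences of a parallel Nijenhuis tensor\<close>

context
  assumes parallel: "\<And>X Y Z. \<lbrakk>X \<in> V; Y \<in> V; Z \<in> V\<rbrakk> \<Longrightarrow> D Z (N X Y) = N (D Z X) Y + N X (D Z Y)"
begin

lemma N_A_left:
  assumes "X \<in> V" "Y \<in> V" "Z \<in> V"
  shows "N (A Z X) Y = - A Z (N X Y)"
proof -
  have "D Z (J X) = A Z X + J (D Z X)" by (simp add: A_def)
  then have "N (A Z X) Y = N (D Z (J X)) Y - N (J (D Z X)) Y"
    using assms by (simp add: N_add_left)
  also have "\<dots> = D Z (N (J X) Y) - N (J X) (D Z Y) - N (J (D Z X)) Y"
    using assms by (simp add: parallel)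
  \<comment> \<open>\<open>J\<close> comes out of both correction terms, and parallelism at
    \<open>X\<close>, \<open>Y\<close> recombines them into one derivative of
    \<open>N X Y\<close>.\<close>
  also have "\<dots> = - D Z (J (N X Y)) + J (D Z (N X Y))"
    using assms by (simp add: N_J_left parallel)
  finally show ?thesis by (simp add: A_def)
qed

lemma N_A_right:
  assumes "X \<in> V" "Y \<in> V" "Z \<in> V"
  shows "N X (A Z Y) = - A Z (N X Y)"
  using assms N_skew [of "A Z Y" X] N_skew [of Y X] by (simp add: N_A_left)

text \<open>\<open>A W\<close> is parked in the second slot while \<open>A Z\<close> passes into the
  first; brought back, \<open>A W\<close> stands outermost.\<close>

lemma N_A_commute:
  assumes "X \<in> V" "Y \<in> V" "Z \<in> V" "W \<in> V"
  shows "N (A Z (A W X)) Y = N (A W (A Z X)) Y"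
proof -
  have "N (A Z (A W X)) Y = - A Z (N (A W X) Y)"
    using assms by (simp add: N_A_left)
  also have "\<dots> = - A Z (N X (A W Y))"
    using assms by (simp add: N_A_left N_A_right)
  also have "\<dots> = N (A Z X) (A W Y)"
    using assms by (simp add: N_A_left)
  also have "\<dots> = N (A W (A Z X)) Y"
    using assms by (simp add: N_A_left N_A_right)
  finally show ?thesis .
qed

lemma N_A_A:
  assumes "X \<in> V" "Y \<in> V" "Z \<in> V"
  shows "N (A Z (A Z X)) Y = 0"
proof -
  define U where "U = A Z (A Z X)"
  have U: "U \<in> V" using assms by (simp add: U_def)
  \<comment> \<open>Taking \<open>J Z\<close> for the second direction, conjugate-linearity turns
    the two orders of composition into \<open>J U\<close> and \<open>- J U\<close>.\<close>
  have "N (J U) Y = N (- J U) Y"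
    using N_A_commute [of X Y Z "J Z"] assms by (simp add: A_J_left A_J_right U_def)
  also have "\<dots> = - N (J U) Y"
    using assms U additive_on_V(2) [of "\<lambda>X. N X Y" "J U"] by (simp add: N_add_left)
  finally have "2 *\<^sub>R N (J U) Y = 0" by (simp add: scaleR_2 eq_neg_iff_add_eq_0)
  then have "J (N U Y) = 0" using assms U by (simp add: N_J_left)
  then have "J (J (N U Y)) = 0" by simp
  then show ?thesis using assms U by (simp add: U_def)
qed

lemma A_eq_0:
  assumes "X \<in> V" "Z \<in> V"
  shows "A Z X = 0"
proof -
  define U where "U = A Z (A Z X)"
  have U: "U \<in> V" using assms by (simp add: U_def)
  have "g (A Z U) (J Y) = 0" if "Y \<in> V" for Y
    using g_N [of U Y Z] N_A_A [of X Y Z] assms U that by (simp add: U_def)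
  \<comment> \<open>This choice makes \<open>J Y\<close> equal to \<open>- A Z X\<close>, so that
    skewness of \<open>A Z\<close> turns the pairing into \<open>- g U U\<close>.\<close>
  from this [of "J (A Z X)"] have "g (A Z U) (A Z X) = 0"
    using assms U by simp
  then have "g U U = 0"
    using assms U A_skew [of Z U "A Z X"] by (simp add: U_def)
  then have "A Z (A Z X) = 0" using g_definite U by (simp add: U_def)
  \<comment> \<open>The same descent by skewness, now from the square of \<open>A Z\<close> to
    \<open>A Z\<close> itself.\<close>
  then have "g (A Z X) (A Z X) = 0"
    using assms A_skew [of Z X "A Z X"] by simp
  then show ?thesis using g_definite assms by simp
qed

lemma N_eq_0: "\<lbrakk>X \<in> V; Y \<in> V\<rbrakk> \<Longrightarrow> N X Y = 0"
  by (simp add: N_eq_0_if_A_eq_0 A_eq_0)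

end

end

section \<open>Smooth functions and vector fields\<close>

text \<open>On an open set the derivative depends only on values in the set, so agreement passes to
  all derivatives. It allows the derivative of a sum or multiple to be replaced by its computed form
  on \<open>S\<close>.\<close>

lemma Ck_on_cong:
  assumes "open S" "\<And>x. x \<in> S \<Longrightarrow> f x = g x" "Ck_on n S f"
  shows "Ck_on n S g"
  using assms(2,3)
proof (induction n arbitrary: f g)
  case 0
  then show ?case by (simp cong: continuous_on_cong)
next
  case (Suc n)
  have der: "(g has_derivative frechet_derivative f (at x)) (at x)" if "x \<in> S" for x
    using Suc.prems that assms(1)
    by (auto intro: has_derivative_transform_within_open [of f _ _ _ S]
        simp flip: frechet_derivative_works)
  have "Ck_on n S (\<lambda>x. frechet_derivative g (at x) v)" for v
  proof (rule Suc.IH)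
    show "frechet_derivative f (at x) v = frechet_derivative g (at x) v" if "x \<in> S" for x
      using frechet_derivative_at [OF der [OF that]] by simp
    show "Ck_on n S (\<lambda>x. frechet_derivative f (at x) v)" using Suc.prems by simp
  qed
  then show ?case using der by (auto simp: differentiable_def)
qed

lemma Ck_on_add:
  assumes "open S" "Ck_on n S f" "Ck_on n S g"
  shows "Ck_on n S (\<lambda>x. f x + g x)"
  using assms(2,3)
proof (induction n arbitrary: f g)
  case 0
  then show ?case by (simp add: continuous_on_add)
next
  case (Suc n)
  have "Ck_on n S (\<lambda>x. frechet_derivative (\<lambda>x. f x + g x) (at x) v)" for v
    by (rule Ck_on_cong [OF \<open>open S\<close>, where f =
          "\<lambda>x. frechet_derivative f (at x) v + frechet_derivative g (at x) v"])
      (use Suc in \<open>auto intro!: fun_cong [OF frechet_derivative_at] has_derivative_add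
        simp flip: frechet_derivative_works\<close>)
  then show ?case using Suc.prems by simp
qed

lemma Ck_on_scaleR:
  assumes "open S" "Ck_on n S f"
  shows "Ck_on n S (\<lambda>x. c *\<^sub>R f x)"
  using assms(2)
proof (induction n arbitrary: f)
  case 0
  then show ?case by (simp add: continuous_on_scaleR)
next
  case (Suc n)
  have "Ck_on n S (\<lambda>x. frechet_derivative (\<lambda>x. c *\<^sub>R f x) (at x) v)" for v
    by (rule Ck_on_cong [OF \<open>open S\<close>, where f = "\<lambda>x. c *\<^sub>R frechet_derivative f (at x) v"])
      (use Suc in \<open>auto intro!: fun_cong [OF frechet_derivative_at] has_derivative_scaleR_right
        simp flip: frechet_derivative_works\<close>)
  then show ?case using Suc.prems by simp
qed

section \<open>Vector fields form a real subspace\<close>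

lemma tangent_space_add:
  "\<lbrakk>v \<in> tangent_space \<A> p; w \<in> tangent_space \<A> p\<rbrakk> \<Longrightarrow> v + w \<in> tangent_space \<A> p"
  by (simp add: tangent_space_def algebra_simps)

lemma tangent_space_scaleR:
  "v \<in> tangent_space \<A> p \<Longrightarrow> c *\<^sub>R v \<in> tangent_space \<A> p"
  by (simp add: tangent_space_def scaleR_fun_def algebra_simps)

context
  fixes \<A> :: "('m::{t2_space, second_countable_topology}, 'e::euclidean_space) atlas"
  assumes \<A>: "smooth_manifold \<A>"
begin

lemma open_chart_image: "(U, \<phi>) \<in> \<A> \<Longrightarrow> open (\<phi> ` U)"
  using \<A> unfolding smooth_manifold_def by fast

lemma smooth_fun_add:
  assumes "f \<in> smooth_fun \<A>" "g \<in> smooth_fun \<A>"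
  shows "f + g \<in> smooth_fun \<A>"
proof -
  have "Ck_on n (\<phi> ` U) (\<lambda>x. f (inv_into U \<phi> x) + g (inv_into U \<phi> x))"
    if "(U, \<phi>) \<in> \<A>" for n U \<phi>
    using assms that
    by (intro Ck_on_add open_chart_image) (auto simp: smooth_fun_def smooth_on_def comp_def)
  then show ?thesis by (auto simp: smooth_fun_def smooth_on_def comp_def)
qed

lemma smooth_fun_scaleR:
  assumes "f \<in> smooth_fun \<A>"
  shows "c *\<^sub>R f \<in> smooth_fun \<A>"
proof -
  have "Ck_on n (\<phi> ` U) (\<lambda>x. c *\<^sub>R f (inv_into U \<phi> x))"
    if "(U, \<phi>) \<in> \<A>" for n U \<phi>
    using assms that
    by (intro Ck_on_scaleR open_chart_image) (auto simp: smooth_fun_def smooth_on_def comp_def)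
  then show ?thesis by (auto simp: smooth_fun_def smooth_on_def comp_def scaleR_fun_def)
qed

lemma vector_fields_add:
  assumes "X \<in> vector_fields \<A>" "Y \<in> vector_fields \<A>"
  shows "X + Y \<in> vector_fields \<A>"
proof -
  have "deriv_along (X + Y) f = deriv_along X f + deriv_along Y f" for f
    by (simp add: deriv_along_def fun_eq_iff)
  then show ?thesis
    using assms by (simp add: vector_fields_def tangent_space_add smooth_fun_add)
qed

lemma vector_fields_scaleR:
  assumes "X \<in> vector_fields \<A>"
  shows "c *\<^sub>R X \<in> vector_fields \<A>"
proof -
  have "deriv_along (c *\<^sub>R X) f = c *\<^sub>R deriv_along X f" for f
    by (simp add: deriv_along_def scaleR_fun_def fun_eq_iff)
  moreover have "(c *\<^sub>R X) p = c *\<^sub>R X p" for p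
    by (simp add: scaleR_fun_def)
  ultimately show ?thesis
    using assms by (simp add: vector_fields_def tangent_space_scaleR smooth_fun_scaleR)
qed

lemma zero_vector_field: "0 \<in> vector_fields \<A>"
proof -
  \<comment> \<open>The zero function is smooth as the multiple \<open>0 *\<^sub>R f\<close> of the
    given smooth \<open>f\<close>.\<close>
  have "deriv_along 0 f \<in> smooth_fun \<A>" if "f \<in> smooth_fun \<A>" for f :: "'m \<Rightarrow> real"
    using smooth_fun_scaleR [OF that, of 0] by (simp add: deriv_along_def zero_fun_def)
  then show ?thesis by (simp add: vector_fields_def tangent_space_def)
qed

lemma subspace_vector_fields: "subspace (vector_fields \<A>)"
  by (simp add: subspace_def zero_vector_field vector_fields_add vector_fields_scaleR)

end

section \<open>The manifold as an instance of the algebra\<close>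

theorem proposition5p4:
  fixes \<A> :: "('m::{t2_space, second_countable_topology}, 'e::euclidean_space) atlas"
    and \<omega> :: "'m \<Rightarrow> 'm tvec \<Rightarrow> 'm tvec \<Rightarrow> real"
    and J :: "'m \<Rightarrow> 'm tvec \<Rightarrow> 'm tvec"
    and D :: "'m vfield \<Rightarrow> 'm vfield \<Rightarrow> 'm vfield"
  assumes "symplectic_manifold \<A> \<omega>"
    and "almost_complex_structure \<A> J"
    and "positive_compatible \<A> \<omega> J"
    and "levi_civita_connection \<A> (assoc_metric \<omega> J) D"
  shows "(\<forall>Z\<in>vector_fields \<A>. \<forall>X\<in>vector_fields \<A>. \<forall>Y\<in>vector_fields \<A>.
            cov_deriv12 D (nijenhuis J) Z X Y = 0)
     \<longleftrightarrow> (\<forall>X\<in>vector_fields \<A>. \<forall>Y\<in>vector_fields \<A>. nijenhuis J X Y = 0)"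
proof -
  let ?V = "vector_fields \<A>"
  let ?g = "assoc_metric \<omega> J"
  let ?G = "bilinear_field ?g"
  let ?J = "endo_field J"
  have mf: "smooth_manifold \<A>" and sympl: "symplectic_form \<A> \<omega>"
    using assms(1) by (auto simp: symplectic_manifold_def)
  have tan: "X p \<in> tangent_space \<A> p" if "X \<in> ?V" for X p
    using that by (simp add: vector_fields_def)
  have J_tan: "J p v \<in> tangent_space \<A> p" and J_J: "J p (J p v) = - v"
    if "v \<in> tangent_space \<A> p" for p v
    using assms(2) that by (auto simp: almost_complex_structure_def smooth_endomorphism_def)
  have J_vf: "?J X \<in> ?V" if "X \<in> ?V" for X
    using assms(2) that by (auto simp: almost_complex_structure_def smooth_endomorphism_def)
  have J_lin: "J p (a *\<^sub>R v + b *\<^sub>R w) = a *\<^sub>R J p v + b *\<^sub>R J p w"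
    if "v \<in> tangent_space \<A> p" "w \<in> tangent_space \<A> p" for p v w a b
    using assms(2) that by (auto simp: almost_complex_structure_def smooth_endomorphism_def)
  have g_lin: "?g p (a *\<^sub>R u + b *\<^sub>R v) w = a * ?g p u w + b * ?g p v w"
    if "u \<in> tangent_space \<A> p" "v \<in> tangent_space \<A> p" "w \<in> tangent_space \<A> p" for p u v w a b
    using assms(3) that
    by (auto simp: positive_compatible_def riemannian_metric_def smooth_bilinear_form_def)
  have g_smooth: "?G X Y \<in> smooth_fun \<A>" if "X \<in> ?V" "Y \<in> ?V" for X Y
    using assms(3) that
    by (auto simp: positive_compatible_def riemannian_metric_def smooth_bilinear_form_def)
  have g_sym: "?g p v w = ?g p w v"
    if "v \<in> tangent_space \<A> p" "w \<in> tangent_space \<A> p" for p v w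
    using assms(3) that
    by (auto simp: positive_compatible_def riemannian_metric_def symmetric_form_def)
  have g_pos: "?g p v v > 0" if "v \<in> tangent_space \<A> p" "v \<noteq> 0" for p v
    using assms(3) that by (auto simp: positive_compatible_def riemannian_metric_def)
  have \<omega>_bil: "smooth_bilinear_form \<A> \<omega>"
    using sympl by (simp add: symplectic_form_def)
  have \<omega>_alt: "\<omega> p v v = 0" if "v \<in> tangent_space \<A> p" for p v
    using sympl that by (auto simp: symplectic_form_def)
  have \<omega>_lin: "\<omega> p (a *\<^sub>R u + b *\<^sub>R v) w = a * \<omega> p u w + b * \<omega> p v w"
      "\<omega> p w (a *\<^sub>R u + b *\<^sub>R v) = a * \<omega> p w u + b * \<omega> p w v"
    if "u \<in> tangent_space \<A> p" "v \<in> tangent_space \<A> p" "w \<in> tangent_space \<A> p" for p u v w a b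
    using \<omega>_bil that by (auto simp: smooth_bilinear_form_def)
  have \<omega>_skew: "\<omega> p w v = - \<omega> p v w"
    if "v \<in> tangent_space \<A> p" "w \<in> tangent_space \<A> p" for p v w
    using \<omega>_alt [OF tangent_space_add [OF that]] \<omega>_alt [OF that(1)] \<omega>_alt [OF that(2)]
      \<omega>_lin(1) [of v p w "v + w" 1 1] \<omega>_lin(2) [of v p w v 1 1] \<omega>_lin(2) [of v p w w 1 1]
      tangent_space_add [OF that] that
    by simp
  have g_J_right: "?g p v (J p w) = - \<omega> p v w"
    if "v \<in> tangent_space \<A> p" "w \<in> tangent_space \<A> p" for p v w
    using \<omega>_lin(2) [of w p w v "- 1" 0] that by (simp add: assoc_metric_def J_J)
  have g_J_left: "?g p (J p v) w = \<omega> p v w"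
    if "v \<in> tangent_space \<A> p" "w \<in> tangent_space \<A> p" for p v w
    using g_sym [OF J_tan [OF that(1)] that(2)] g_J_right [OF that(2,1)] \<omega>_skew [OF that] by simp
  \<comment> \<open>This puts \<omega> into the form in which the locale states closedness.\<close>
  have \<omega>_eq: "bilinear_field \<omega> X Y = ?G (?J X) Y" if "X \<in> ?V" "Y \<in> ?V" for X Y
    using that by (simp add: bilinear_field_def endo_field_def g_J_left g_J_right tan)
  have D_closed: "D X Y \<in> ?V" and D_add: "D X (Y + Z) = D X Y + D X Z"
    if "X \<in> ?V" "Y \<in> ?V" "Z \<in> ?V" for X Y Z
    using assms(4) that by (auto simp: levi_civita_connection_def affine_connection_def)
  \<comment> \<open>Torsion-freeness turns the Lie brackets in \<open>ext_deriv2\<close> and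
    \<open>nijenhuis\<close> into the differences used by the locale.\<close>
  have bracket: "lie_bracket X Y = D X Y - D Y X" if "X \<in> ?V" "Y \<in> ?V" for X Y
    using assms(4) that by (simp add: levi_civita_connection_def torsion_free_def)
  have diff_vf: "X - Y \<in> ?V" if "X \<in> ?V" "Y \<in> ?V" for X Y
    using subspace_diff [OF subspace_vector_fields [OF mf]] that .
  interpret almost_kaehler_algebra ?V ?J D ?G deriv_along
  proof
    show "subspace ?V" by (rule subspace_vector_fields [OF mf])
    fix X Y Z assume X: "X \<in> ?V"
    show "?J X \<in> ?V" using X by (rule J_vf)
    show "?J (?J X) = - X" using X by (simp add: endo_field_def J_J tan fun_eq_iff)
    \<comment> \<open>Zero here is the zero function, so pointwise positivity applies at every
      \<open>p\<close>.\<close>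
    show "X = 0" if "?G X X = 0"
    proof
      fix p
      have "?g p (X p) (X p) = 0" using that by (simp add: bilinear_field_def fun_eq_iff)
      then show "X p = 0 p" using g_pos [OF tan [OF X], of p] by force
    qed
    assume Y: "Y \<in> ?V"
    show "?J (X + Y) = ?J X + ?J Y"
      using J_lin [OF tan [OF X] tan [OF Y], of _ 1 1] by (simp add: endo_field_def fun_eq_iff)
    show "D X Y \<in> ?V" using D_closed X Y by blast
    show "?G X Y = ?G Y X"
      unfolding bilinear_field_def by (rule ext) (rule g_sym [OF tan [OF X] tan [OF Y]])
    show "?G (?J X) Y = - ?G X (?J Y)"
      using X Y by (simp add: bilinear_field_def endo_field_def g_J_left g_J_right tan fun_eq_iff)
    assume Z: "Z \<in> ?V"
    show "D X (Y + Z) = D X Y + D X Z" using D_add X Y Z by blast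
    show "?G (X + Y) Z = ?G X Z + ?G Y Z"
      using g_lin [OF tan [OF X] tan [OF Y] tan [OF Z], of _ 1 1]
      by (simp add: bilinear_field_def fun_eq_iff)
    \<comment> \<open>A tangent vector is homogeneous on smooth functions, hence the appeal to
      \<open>g_smooth\<close>.\<close>
    have "X p (- 1 *\<^sub>R ?G Y Z) = - 1 * X p (?G Y Z)" for p
      using tan [OF X, of p] g_smooth [OF Y Z] unfolding tangent_space_def by blast
    then show "deriv_along X (- ?G Y Z) = - deriv_along X (?G Y Z)"
      by (simp add: deriv_along_def fun_eq_iff)
    show "deriv_along X (?G Y Z) = ?G (D X Y) Z + ?G Y (D X Z)"
      using assms(4) X Y Z by (simp add: levi_civita_connection_def metric_connection_def)
    have "ext_deriv2 \<omega> X Y Z = 0"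
      using sympl X Y Z by (simp add: symplectic_form_def)
    then show "deriv_along X (?G (?J Y) Z) - deriv_along Y (?G (?J X) Z)
        + deriv_along Z (?G (?J X) Y) - ?G (?J (D X Y - D Y X)) Z
        + ?G (?J (D X Z - D Z X)) Y - ?G (?J (D Y Z - D Z Y)) X = 0"
      using X Y Z by (simp add: ext_deriv2_def bracket \<omega>_eq diff_vf D_closed)
  qed
  have nij: "nijenhuis J X Y = N X Y" if "X \<in> ?V" "Y \<in> ?V" for X Y
    using that by (simp add: nijenhuis_def N_def bracket bracket_def)
  show ?thesis
  proof (intro iffI ballI)
    fix X Y
    assume "\<forall>Z\<in>?V. \<forall>X\<in>?V. \<forall>Y\<in>?V. cov_deriv12 D (nijenhuis J) Z X Y = 0" "X \<in> ?V" "Y \<in> ?V"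
    \<comment> \<open>Regrouping the two subtracted terms puts the vanishing of
      \<open>cov_deriv12\<close> into the form of the assumption \<open>parallel\<close>.\<close>
    then show "nijenhuis J X Y = 0"
      using N_eq_0 [of X Y] by (simp add: nij cov_deriv12_def diff_diff_eq)
  next
    fix X Y Z
    assume "\<forall>X\<in>?V. \<forall>Y\<in>?V. nijenhuis J X Y = 0" "X \<in> ?V" "Y \<in> ?V" "Z \<in> ?V"
    \<comment> \<open>All three terms vanish: \<open>D Z 0 = 0\<close> by additivity, and the others
      are values of the Nijenhuis tensor on vector fields.\<close>
    then show "cov_deriv12 D (nijenhuis J) Z X Y = 0"
      by (simp add: cov_deriv12_def)
  qed
qed

end
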